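(* Let $(X,d)$ be an infinite metric space and let $\mathfrak{B}$ be a bornology on $X$ with a compact base $\mathfrak{B}_0$ such that $X\notin\mathfrak{B}$. The following statements are equivalent. (1) $\mathfrak{B}_0$ is uncountable. (2) $(C(X),\tau^s_{\mathfrak{B}})$ is discretely selective.
   Context: A bornology on a set $X$ is a family $\mathfrak{B}$ of subsets of $X$ that covers $X$, is closed under finite unions and is closed under taking subsets. A base of $\mathfrak{B}$ is a subfamily $\mathfrak{B}_0\subseteq\mathfrak{B}$ such that every $B\in\mathfrak{B}$ is contained in some $B_0\in\mathfrak{B}_0$; it is a compact base if all its members are compact. For $B\subseteq X$ and $\delta>0$, $B^\delta=\bigcup_{x\in B}\{y\in X: d(x,y)<\delta\}$. $C(X)$ is the set of continuous functions $X\to\mathbb{R}$. The topology $\tau^s_{\mathfrak{B}}$ of strong uniform convergence on $\mathfrak{B}$ is the topology on $C(X)$ induced by the uniformity with base consisting of the sets $[B,\varepsilon]^s=\{(f,g): \exists\delta>0\ \forall x\in B^\delta,\ |f(x)-g(x)|<\varepsilon\}$, $B\in\mathfrak{B}$, $\varepsilon>0$. A space $Y$ is discretely selective if for every sequence $\{U_n:n\in\mathbb{N}\}$ of nonempty open subsets of $Y$ there are $y_n\in U_n$ for each $n$ such that the set $\{y_n:n\in\mathbb{N}\}$ is closed and discrete in $Y$.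
   Formalization: Condition (1) is read as "every compact base of the bornology is uncountable": for one given base the claim fails, e.g. for the real line with the bounded sets and the uncountable compact base of all [-r,r], r>0, where C(X) is not discretely selective. *)

theory Defs
  imports "HOL-Analysis.Analysis"
begin

definition bornology :: "'a set set \<Rightarrow> bool" where
  "bornology \<BB> \<longleftrightarrow>
     \<Union>\<BB> = UNIV \<and>
     (\<forall>\<F>. finite \<F> \<and> \<F> \<subseteq> \<BB> \<longrightarrow> \<Union>\<F> \<in> \<BB>) \<and>
     (\<forall>B\<in>\<BB>. \<forall>A. A \<subseteq> B \<longrightarrow> A \<in> \<BB>)"

definition bornology_base :: "'a set set \<Rightarrow> 'a set set \<Rightarrow> bool" where
  "bornology_base \<BB> \<BB>\<^sub>0 \<longleftrightarrow> \<BB>\<^sub>0 \<subseteq> \<BB> \<and> (\<forall>B\<in>\<BB>. \<exists>B\<^sub>0\<in>\<BB>\<^sub>0. B \<subseteq> B\<^sub>0)"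

definition compact_base :: "'a::topological_space set set \<Rightarrow> 'a set set \<Rightarrow> bool" where
  "compact_base \<BB> \<BB>\<^sub>0 \<longleftrightarrow> bornology_base \<BB> \<BB>\<^sub>0 \<and> (\<forall>K\<in>\<BB>\<^sub>0. compact K)"

definition enlargement :: "'a::metric_space set \<Rightarrow> real \<Rightarrow> 'a set" where
  "enlargement B \<delta> = (\<Union>x\<in>B. ball x \<delta>)"

definition cont_funs :: "('a::topological_space \<Rightarrow> real) set" where
  "cont_funs = {f. continuous_on UNIV f}"

definition strong_entourage ::
    "'a::metric_space set \<Rightarrow> real \<Rightarrow> (('a \<Rightarrow> real) \<times> ('a \<Rightarrow> real)) set" where
  "strong_entourage B \<epsilon> =
     {(f, g) \<in> cont_funs \<times> cont_funs. \<exists>\<delta>>0. \<forall>x\<in>enlargement B \<delta>. \<bar>f x - g x\<bar> < \<epsilon>}"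

definition strong_uniformity ::
    "'a::metric_space set set \<Rightarrow> (('a \<Rightarrow> real) \<times> ('a \<Rightarrow> real)) set set" where
  "strong_uniformity \<BB> =
     {E. E \<subseteq> cont_funs \<times> cont_funs \<and> (\<exists>B\<in>\<BB>. \<exists>\<epsilon>>0. strong_entourage B \<epsilon> \<subseteq> E)}"

definition strong_topology :: "'a::metric_space set set \<Rightarrow> ('a \<Rightarrow> real) topology" where
  "strong_topology \<BB> =
     topology (\<lambda>U. U \<subseteq> cont_funs \<and> (\<forall>f\<in>U. \<exists>E\<in>strong_uniformity \<BB>. E `` {f} \<subseteq> U))"

definition discretely_selective :: "'b topology \<Rightarrow> bool" where
  "discretely_selective Y \<longleftrightarrow>
     (\<forall>U::nat \<Rightarrow> 'b set. (\<forall>n. openin Y (U n) \<and> U n \<noteq> {}) \<longrightarrow>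
        (\<exists>y. (\<forall>n. y n \<in> U n) \<and> closedin Y (range y) \<and>
             subtopology Y (range y) = discrete_topology (range y)))"

text \<open>
  \<^const>\<open>topology\<close> yields a meaningful result only for predicates satisfying
  \<^const>\<open>istopology\<close>; for a bornology this holds, and the carrier is all of
  \<^const>\<open>cont_funs\<close>.
\<close>

lemma strong_entourage_antimono:
  assumes "A \<subseteq> B" "b \<le> a"
  shows "strong_entourage B b \<subseteq> strong_entourage A a"
proof
  fix p assume "p \<in> strong_entourage B b"
  then obtain f g \<delta> where p: "p = (f, g)" "f \<in> cont_funs" "g \<in> cont_funs" "\<delta> > 0"
    and fg: "\<forall>x\<in>enlargement B \<delta>. \<bar>f x - g x\<bar> < b"
    unfolding strong_entourage_def by blast
  have "enlargement A \<delta> \<subseteq> enlargement B \<delta>"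
    using assms(1) unfolding enlargement_def by blast
  then have "\<forall>x\<in>enlargement A \<delta>. \<bar>f x - g x\<bar> < a"
    using fg assms(2) by (meson less_le_trans subsetD)
  then show "p \<in> strong_entourage A a"
    using p unfolding strong_entourage_def by blast
qed

lemma strong_uniformity_Int:
  assumes "bornology \<BB>" "E \<in> strong_uniformity \<BB>" "F \<in> strong_uniformity \<BB>"
  shows "E \<inter> F \<in> strong_uniformity \<BB>"
proof -
  obtain A a where A: "A \<in> \<BB>" "a > 0" "strong_entourage A a \<subseteq> E"
    using assms(2) unfolding strong_uniformity_def by blast
  obtain B b where B: "B \<in> \<BB>" "b > 0" "strong_entourage B b \<subseteq> F"
    using assms(3) unfolding strong_uniformity_def by blast
  have "\<Union>{A, B} \<in> \<BB>"
    using assms(1) A(1) B(1) unfolding bornology_def by (metis empty_subsetI finite.emptyI finite_insert insert_subset)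
  then have "A \<union> B \<in> \<BB>" by simp
  moreover have "strong_entourage (A \<union> B) (min a b) \<subseteq> strong_entourage A a \<inter> strong_entourage B b"
    by (simp add: strong_entourage_antimono)
  moreover have "min a b > 0" using A B by simp
  moreover have "E \<inter> F \<subseteq> cont_funs \<times> cont_funs"
    using assms(2) unfolding strong_uniformity_def by blast
  ultimately show ?thesis
    using A(3) B(3) unfolding strong_uniformity_def by blast
qed

lemma istopology_strong:
  assumes "bornology \<BB>"
  shows "istopology (\<lambda>U. U \<subseteq> cont_funs \<and> (\<forall>f\<in>U. \<exists>E\<in>strong_uniformity \<BB>. E `` {f} \<subseteq> U))"
  unfolding istopology_def
proof (intro conjI allI impI; (elim conjE)?)
  fix S T :: "('a \<Rightarrow> real) set"
  assume S: "\<forall>f\<in>S. \<exists>E\<in>strong_uniformity \<BB>. E `` {f} \<subseteq> S"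
    and T: "\<forall>f\<in>T. \<exists>E\<in>strong_uniformity \<BB>. E `` {f} \<subseteq> T"
  show "\<forall>f\<in>S \<inter> T. \<exists>E\<in>strong_uniformity \<BB>. E `` {f} \<subseteq> S \<inter> T"
  proof
    fix f assume "f \<in> S \<inter> T"
    then obtain E F where "E \<in> strong_uniformity \<BB>" "E `` {f} \<subseteq> S"
        "F \<in> strong_uniformity \<BB>" "F `` {f} \<subseteq> T"
      using S T by blast
    then show "\<exists>E\<in>strong_uniformity \<BB>. E `` {f} \<subseteq> S \<inter> T"
      using strong_uniformity_Int[OF assms] by (intro bexI[of _ "E \<inter> F"]) auto
  qed
next
  fix \<K> :: "('a \<Rightarrow> real) set set"
  assume \<K>: "\<forall>K\<in>\<K>. K \<subseteq> cont_funs \<and> (\<forall>f\<in>K. \<exists>E\<in>strong_uniformity \<BB>. E `` {f} \<subseteq> K)"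
  then show "\<Union>\<K> \<subseteq> cont_funs" by blast
  show "\<forall>f\<in>\<Union>\<K>. \<exists>E\<in>strong_uniformity \<BB>. E `` {f} \<subseteq> \<Union>\<K>"
  proof
    fix f assume "f \<in> \<Union>\<K>"
    then obtain K E where "K \<in> \<K>" "E \<in> strong_uniformity \<BB>" "E `` {f} \<subseteq> K"
      using \<K> by blast
    then show "\<exists>E\<in>strong_uniformity \<BB>. E `` {f} \<subseteq> \<Union>\<K>" by blast
  qed
qed blast

lemma openin_strong_topology:
  assumes "bornology \<BB>"
  shows "openin (strong_topology \<BB>) U \<longleftrightarrow>
    U \<subseteq> cont_funs \<and> (\<forall>f\<in>U. \<exists>E\<in>strong_uniformity \<BB>. E `` {f} \<subseteq> U)"
  unfolding strong_topology_def by (simp add: topology_inverse'[OF istopology_strong[OF assms]])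

lemma topspace_strong_topology:
  assumes "bornology \<BB>"
  shows "topspace (strong_topology \<BB>) = cont_funs"
proof -
  obtain B where "B \<in> \<BB>" using assms unfolding bornology_def by blast
  then have "cont_funs \<times> cont_funs \<in> strong_uniformity \<BB>"
    unfolding strong_uniformity_def strong_entourage_def
    by (auto intro!: bexI[of _ B] exI[of _ "1::real"])
  then have "openin (strong_topology \<BB>) cont_funs"
    unfolding openin_strong_topology[OF assms] by auto
  then show ?thesis
    by (metis openin_strong_topology[OF assms] openin_subset openin_topspace subset_antisym)
qed

end

theory Submission
  imports Defs
begin

text \<open>
  On a compact set, strong uniform closeness of continuous functions is just uniform closeness.
  If there is a countable compact base, zero has a countable neighbourhood base, and any selection
  of nonzero functions from shrinking neighbourhoods of zero accumulates at zero. If there is none,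
  the compact sets controlling the given open sets form a countable family that is not a base, so
  some compact member of the bornology lies in none of them. Adding bumps supported off these sets
  but centred in that member gives a selection whose values there are unbounded, and such a
  selection is locally finite because every continuous function is bounded on a compact set.
\<close>

section \<open>Bornologies and strong entourages\<close>

lemma bornology_UN:
  assumes "bornology \<BB>" "finite I" "\<And>i. i \<in> I \<Longrightarrow> A i \<in> \<BB>"
  shows "(\<Union>i\<in>I. A i) \<in> \<BB>"
proof -
  have "finite (A ` I)" "A ` I \<subseteq> \<BB>" using assms(2,3) by auto
  then show ?thesis using assms(1) unfolding bornology_def by simp
qed

lemma bornology_singleton: "bornology \<BB> \<Longrightarrow> {p} \<in> \<BB>"
  unfolding bornology_def by (metis UNIV_I UnionE empty_subsetI insert_subset)

lemma subset_enlargement: "\<delta> > 0 \<Longrightarrow> B \<subseteq> enlargement B \<delta>"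
  unfolding enlargement_def by auto

lemma strong_entourage_in_uniformity:
  "B \<in> \<BB> \<Longrightarrow> \<epsilon> > 0 \<Longrightarrow> strong_entourage B \<epsilon> \<in> strong_uniformity \<BB>"
  unfolding strong_uniformity_def strong_entourage_def by blast

lemma strong_entourage_imp_close:
  "(f, g) \<in> strong_entourage B \<epsilon> \<Longrightarrow> x \<in> B \<Longrightarrow> \<bar>f x - g x\<bar> < \<epsilon>"
  unfolding strong_entourage_def using subset_enlargement by blast

text \<open>The set where f and g differ by less than \<epsilon> is open. Containing the compact set
  K, it contains an enlargement of K.\<close>

lemma strong_entourage_compactI:
  assumes "compact K" "f \<in> cont_funs" "g \<in> cont_funs" "\<And>x. x \<in> K \<Longrightarrow> \<bar>f x - g x\<bar> < \<epsilon>"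
  shows "(f, g) \<in> strong_entourage K \<epsilon>"
proof -
  have cont: "continuous_on UNIV f" "continuous_on UNIV g"
    using assms(2,3) unfolding cont_funs_def by auto
  have op: "open {x. \<bar>f x - g x\<bar> < \<epsilon>}"
    by (intro open_Collect_less continuous_intros cont)
  then obtain \<delta> where "\<delta> > 0" "(\<Union>x\<in>K. ball x \<delta>) \<subseteq> {x. \<bar>f x - g x\<bar> < \<epsilon>}"
    using compact_subset_open_imp_ball_epsilon_subset[OF assms(1) op] assms(4) by blast
  then have "\<forall>x\<in>enlargement K \<delta>. \<bar>f x - g x\<bar> < \<epsilon>" unfolding enlargement_def by blast
  then show ?thesis
    using assms(2,3) \<open>\<delta> > 0\<close> unfolding strong_entourage_def by auto
qed

text \<open>A single bound r below \<epsilon>, in place of pointwise strict inequalities on B,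
  leaves the uniform margin \<epsilon> - r for perturbing f.\<close>

lemma openin_strong_topology_close:
  assumes "bornology \<BB>" "B \<in> \<BB>"
  shows "openin (strong_topology \<BB>) {f \<in> cont_funs. \<exists>r<\<epsilon>. \<forall>x\<in>B. \<bar>f x\<bar> \<le> r}" (is "openin _ ?U")
  unfolding openin_strong_topology[OF assms(1)]
proof (intro conjI ballI)
  fix f assume "f \<in> ?U"
  then obtain r where r: "r < \<epsilon>" "\<forall>x\<in>B. \<bar>f x\<bar> \<le> r" by blast
  \<comment> \<open>Spending half of the margin gives the bound (\<epsilon> + r) / 2, still below
    \<epsilon>.\<close>
  let ?E = "strong_entourage B ((\<epsilon> - r) / 2)"
  have "?E `` {f} \<subseteq> ?U"
  proof clarify
    fix g assume fg: "(f, g) \<in> ?E"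
    have "\<bar>g x\<bar> \<le> (\<epsilon> + r) / 2" if "x \<in> B" for x
    proof -
      have "\<bar>g x\<bar> \<le> \<bar>f x\<bar> + \<bar>f x - g x\<bar>" by linarith
      also have "\<dots> \<le> r + (\<epsilon> - r) / 2"
        using strong_entourage_imp_close[OF fg that] r(2) that by (intro add_mono) auto
      finally show ?thesis by (simp add: field_simps)
    qed
    moreover have "(\<epsilon> + r) / 2 < \<epsilon>" using r(1) by simp
    moreover have "g \<in> cont_funs" using fg unfolding strong_entourage_def by blast
    ultimately show "g \<in> cont_funs \<and> (\<exists>r<\<epsilon>. \<forall>x\<in>B. \<bar>g x\<bar> \<le> r)" by blast
  qed
  then show "\<exists>E\<in>strong_uniformity \<BB>. E `` {f} \<subseteq> ?U"
    using strong_entourage_in_uniformity[OF assms(2), of "(\<epsilon> - r) / 2"] r(1)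
    by (intro bexI[of _ ?E]) auto
qed blast

section \<open>Separation, locally finite families and bumps\<close>

lemma separating_entourage:
  assumes "bornology \<BB>" "f \<noteq> g"
  shows "\<exists>E\<in>strong_uniformity \<BB>. (f, g) \<notin> E"
proof -
  obtain p where "f p \<noteq> g p" using assms(2) by blast
  then have "\<bar>f p - g p\<bar> > 0" by simp
  \<comment> \<open>The entourage of the singleton \<open>{p}\<close> with radius exactly the gap at
    p excludes the pair, since its inequality is strict.\<close>
  then show ?thesis
    using strong_entourage_in_uniformity[OF bornology_singleton[OF assms(1)], of "\<bar>f p - g p\<bar>" p]
      strong_entourage_imp_close[of f g "{p}" "\<bar>f p - g p\<bar>" p] by blast
qed

lemma separating_entourage_finite:
  assumes "bornology \<BB>" "finite F" "f \<notin> F"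
  shows "\<exists>E\<in>strong_uniformity \<BB>. E `` {f} \<inter> F = {}"
  using assms(2,3)
proof (induction F)
  case empty
  then show ?case
    using strong_entourage_in_uniformity[OF bornology_singleton[OF assms(1)] zero_less_one] by blast
next
  case (insert g F)
  then obtain E E' where "E \<in> strong_uniformity \<BB>" "E `` {f} \<inter> F = {}"
      "E' \<in> strong_uniformity \<BB>" "(f, g) \<notin> E'"
    using separating_entourage[OF assms(1)] by (metis insertCI)
  then show ?case
    using strong_uniformity_Int[OF assms(1)] by (intro bexI[of _ "E \<inter> E'"]) auto
qed

text \<open>A point outside S has a neighbourhood meeting S in finitely many points, and separation
  shrinks it to one that misses these as well.\<close>

lemma closedin_strong_topology_locally_finite:
  assumes "bornology \<BB>" "S \<subseteq> cont_funs"
    and fin: "\<And>h. h \<in> cont_funs \<Longrightarrow> \<exists>E\<in>strong_uniformity \<BB>. finite (S \<inter> E `` {h})"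
  shows "closedin (strong_topology \<BB>) S"
proof -
  have "\<exists>E\<in>strong_uniformity \<BB>. E `` {h} \<subseteq> cont_funs - S" if h: "h \<in> cont_funs - S" for h
  proof -
    obtain E where E: "E \<in> strong_uniformity \<BB>" "finite (S \<inter> E `` {h})" using fin h by blast
    obtain E' where E': "E' \<in> strong_uniformity \<BB>" "E' `` {h} \<inter> (S \<inter> E `` {h}) = {}"
      using separating_entourage_finite[OF assms(1) E(2), of h] h by blast
    \<comment> \<open>This keeps the neighbourhood of h inside the carrier.\<close>
    have "E \<subseteq> cont_funs \<times> cont_funs" using E(1) unfolding strong_uniformity_def by blast
    then show ?thesis
      using strong_uniformity_Int[OF assms(1) E(1) E'(1)] E'(2) by (intro bexI[of _ "E \<inter> E'"]) auto
  qed
  then show ?thesis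
    unfolding closedin_def openin_strong_topology[OF assms(1)] topspace_strong_topology[OF assms(1)]
    using assms(2) by blast
qed

lemma subtopology_eq_discrete_topology_if_closedin:
  assumes "\<And>T. T \<subseteq> S \<Longrightarrow> closedin X T"
  shows "subtopology X S = discrete_topology S"
proof -
  have S: "S \<subseteq> topspace X" using assms closedin_subset by blast
  have "openin (subtopology X S) T" if "T \<subseteq> S" for T
  proof -
    have "openin X (topspace X - (S - T))" using assms[of "S - T"] by (simp add: openin_diff)
    moreover have "T = (topspace X - (S - T)) \<inter> S" using S that by blast
    ultimately show ?thesis unfolding openin_subtopology by blast
  qed
  then show ?thesis
    unfolding topology_eq by (metis openin_discrete_topology openin_subset topspace_subtopology_subset S)
qed

lemma continuous_prescribe_value_off_closed:
  fixes p :: "'a::metric_space"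
  assumes "closed L" "p \<notin> L" "f \<in> cont_funs"
  obtains g :: "'a \<Rightarrow> real" where "g \<in> cont_funs" "g p = c" "\<And>x. x \<in> L \<Longrightarrow> g x = f x"
proof -
  obtain \<delta> where \<delta>: "\<delta> > 0" "ball p \<delta> \<subseteq> - L"
    using assms(1,2) by (meson ComplI open_Compl open_contains_ball_eq)
  \<comment> \<open>A tent of height 1 at p that vanishes from distance \<delta> on, scaled to move
    the value at p from \<open>f p\<close> to c.\<close>
  define g where "g x = f x + (c - f p) * max 0 (1 - dist p x / \<delta>)" for x
  have "continuous_on UNIV g"
    using assms(3) \<delta>(1) unfolding g_def cont_funs_def by (auto intro!: continuous_intros)
  moreover have "g x = f x" if "x \<in> L" for x
  proof -
    have "dist p x \<ge> \<delta>" using \<delta>(2) that by (meson ComplD linorder_not_less mem_ball subsetD)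
    then show ?thesis using \<delta>(1) by (simp add: g_def)
  qed
  ultimately show thesis using that[of g] by (simp add: cont_funs_def g_def)
qed

section \<open>The two implications\<close>

lemma not_discretely_selective_if_countable_base:
  assumes born: "bornology \<BB>" and base: "compact_base \<BB> \<BB>\<^sub>0" and "countable \<BB>\<^sub>0"
  shows "\<not> discretely_selective (strong_topology \<BB>)"
proof
  assume sel: "discretely_selective (strong_topology \<BB>)"
  have sub: "\<BB>\<^sub>0 \<subseteq> \<BB>" and comp: "\<And>K. K \<in> \<BB>\<^sub>0 \<Longrightarrow> compact K"
    and cover: "\<And>B. B \<in> \<BB> \<Longrightarrow> \<exists>K\<in>\<BB>\<^sub>0. B \<subseteq> K"
    using base unfolding compact_base_def bornology_base_def by auto
  have "\<BB>\<^sub>0 \<noteq> {}" using cover bornology_singleton[OF born] by blast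
  then obtain b :: "nat \<Rightarrow> 'a set" where b: "\<BB>\<^sub>0 = range b"
    using \<open>countable \<BB>\<^sub>0\<close> range_from_nat_into by metis
  \<comment> \<open>Finite unions make the sequence increasing, so one index can serve both a given
    member of the bornology and a given radius.\<close>
  define D where "D n = (\<Union>i\<in>{..n}. b i)" for n
  have D: "D n \<in> \<BB>" "compact (D n)" for n
    unfolding D_def using b sub comp by (auto intro!: bornology_UN[OF born])
  \<comment> \<open>Excluding zero from every open set keeps it out of the selection, so
    accumulation at zero contradicts closedness.\<close>
  define V :: "('a \<Rightarrow> real) set" where "V = cont_funs - {\<lambda>x. 0}"
  have zero: "(\<lambda>x. 0) \<in> cont_funs" unfolding cont_funs_def by simp
  have "closedin (strong_topology \<BB>) {\<lambda>x. 0}"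
    using strong_entourage_in_uniformity[OF bornology_singleton[OF born] zero_less_one] zero
    by (intro closedin_strong_topology_locally_finite[OF born]) auto
  then have V: "openin (strong_topology \<BB>) V"
    unfolding V_def closedin_def topspace_strong_topology[OF born] by blast
  define U where
    "U n = {f \<in> cont_funs. \<exists>r<1 / real (Suc n). \<forall>x\<in>D n. \<bar>f x\<bar> \<le> r} \<inter> V" for n
  have "openin (strong_topology \<BB>) (U n)" for n
    unfolding U_def using openin_strong_topology_close[OF born D(1)] V by blast
  moreover have "U n \<noteq> {}" for n
  proof -
    \<comment> \<open>A nonzero constant strictly below the radius shows that removing zero leaves
      \<open>U n\<close> nonempty.\<close>
    define c where "c = 1 / (2 * real (Suc n))"
    have "0 < c" "c < 1 / real (Suc n)" unfolding c_def by (auto simp: divide_simps)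
    then have "(\<lambda>x. c) \<in> U n"
      unfolding U_def V_def cont_funs_def by (auto intro!: exI[of _ c] simp: fun_eq_iff)
    then show ?thesis by blast
  qed
  ultimately obtain y where y: "\<And>n. y n \<in> U n" "closedin (strong_topology \<BB>) (range y)"
    using sel unfolding discretely_selective_def by metis
  have "y n \<noteq> (\<lambda>x. 0)" for n using y(1)[of n] unfolding U_def V_def by blast
  then have "(\<lambda>x. 0) \<in> cont_funs - range y" using zero by (metis DiffI rangeE)
  then obtain E where E: "E \<in> strong_uniformity \<BB>" "E `` {\<lambda>x. 0} \<subseteq> cont_funs - range y"
    using y(2) unfolding closedin_def openin_strong_topology[OF born] topspace_strong_topology[OF born]
    by blast
  then obtain B \<epsilon> where B: "B \<in> \<BB>" "\<epsilon> > 0" "strong_entourage B \<epsilon> \<subseteq> E"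
    unfolding strong_uniformity_def by blast
  obtain m where m: "B \<subseteq> b m" using cover[OF B(1)] b by blast
  obtain k where k: "1 / real (Suc k) < \<epsilon>" using nat_approx_posE[OF B(2)] by blast
  define n where "n = max m k"
  have "B \<subseteq> D n" using m unfolding D_def n_def by force
  have "1 / real (Suc n) \<le> 1 / real (Suc k)" unfolding n_def by (intro divide_left_mono) auto
  then have "1 / real (Suc n) \<le> \<epsilon>" using k by simp
  have "y n \<in> cont_funs" "\<And>x. x \<in> D n \<Longrightarrow> \<bar>0 - y n x\<bar> < 1 / real (Suc n)"
    using y(1)[of n] unfolding U_def by fastforce+
  then have "(\<lambda>x. 0, y n) \<in> strong_entourage (D n) (1 / real (Suc n))"
    using strong_entourage_compactI[OF D(2) zero] by blast
  then have "(\<lambda>x. 0, y n) \<in> E"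
    using strong_entourage_antimono[OF \<open>B \<subseteq> D n\<close> \<open>1 / real (Suc n) \<le> \<epsilon>\<close>] B(3) by blast
  then show False using E(2) by blast
qed

text \<open>The assumption \<open>unc\<close> ranges over all compact bases because it is applied to
  the family \<open>range K\<close> chosen from the given open sets, not to
  \<open>\<BB>\<^sub>0\<close>.\<close>

lemma discretely_selective_if_no_countable_base:
  assumes born: "bornology \<BB>" and base: "compact_base \<BB> \<BB>\<^sub>0"
    and unc: "\<And>\<BB>\<^sub>1. compact_base \<BB> \<BB>\<^sub>1 \<Longrightarrow> uncountable \<BB>\<^sub>1"
  shows "discretely_selective (strong_topology \<BB>)"
  unfolding discretely_selective_def
proof (intro allI impI)
  fix U :: "nat \<Rightarrow> ('a \<Rightarrow> real) set"
  assume U: "\<forall>n. openin (strong_topology \<BB>) (U n) \<and> U n \<noteq> {}"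
  have sub: "\<BB>\<^sub>0 \<subseteq> \<BB>" and comp: "\<And>K. K \<in> \<BB>\<^sub>0 \<Longrightarrow> compact K"
    and cover: "\<And>B. B \<in> \<BB> \<Longrightarrow> \<exists>K\<in>\<BB>\<^sub>0. B \<subseteq> K"
    using base unfolding compact_base_def bornology_base_def by auto
  have "\<exists>f K \<epsilon>. f \<in> cont_funs \<and> K \<in> \<BB>\<^sub>0 \<and> \<epsilon> > 0 \<and> strong_entourage K \<epsilon> `` {f} \<subseteq> U n" for n
  proof -
    obtain f where f: "f \<in> U n" using U by blast
    then obtain E where E: "f \<in> cont_funs" "E \<in> strong_uniformity \<BB>" "E `` {f} \<subseteq> U n"
      using U unfolding openin_strong_topology[OF born] by blast
    then obtain B \<epsilon> where B: "B \<in> \<BB>" "\<epsilon> > 0" "strong_entourage B \<epsilon> \<subseteq> E"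
      unfolding strong_uniformity_def by blast
    obtain K where K: "K \<in> \<BB>\<^sub>0" "B \<subseteq> K" using cover[OF B(1)] by blast
    have "strong_entourage K \<epsilon> `` {f} \<subseteq> U n"
      using strong_entourage_antimono[OF K(2) order_refl, of \<epsilon>] B(3) E(3) by blast
    then show ?thesis using E(1) K(1) B(2) by blast
  qed
  then obtain f K \<epsilon> where f: "\<And>n::nat. f n \<in> cont_funs" and K: "\<And>n::nat. K n \<in> \<BB>\<^sub>0"
    and \<epsilon>: "\<And>n::nat. \<epsilon> n > 0" and fU: "\<And>n. strong_entourage (K n) (\<epsilon> n) `` {f n} \<subseteq> U n"
    by metis
  have "\<not> compact_base \<BB> (range K)" using unc by blast
  moreover have "range K \<subseteq> \<BB>" "\<forall>L\<in>range K. compact L" using K sub comp by auto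
  ultimately obtain B where B: "B \<in> \<BB>" "\<And>n. \<not> B \<subseteq> K n"
    unfolding compact_base_def bornology_base_def by (metis rangeI)
  \<comment> \<open>B itself may fail to be compact. The larger C is compact and still lies in no
    \<open>K n\<close>.\<close>
  obtain C where C: "C \<in> \<BB>\<^sub>0" "B \<subseteq> C" using cover[OF B(1)] by blast
  have "\<exists>p g. p \<in> C \<and> g \<in> cont_funs \<and> g p = real n \<and> (\<forall>x\<in>K n. g x = f n x)" for n
  proof -
    obtain p where p: "p \<in> C" "p \<notin> K n" using B(2) C(2) by blast
    show ?thesis
      using continuous_prescribe_value_off_closed[OF compact_imp_closed[OF comp[OF K]] p(2) f]
        p(1) by metis
  qed
  then obtain p y where p: "\<And>n. p n \<in> C" "\<And>n. y n (p n) = real n"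
    and y: "\<And>n. y n \<in> cont_funs" "\<And>n x. x \<in> K n \<Longrightarrow> y n x = f n x"
    by metis
  have yU: "y n \<in> U n" for n
  proof -
    \<comment> \<open>The two functions agree on \<open>K n\<close>, so their difference there is
      0.\<close>
    have "(f n, y n) \<in> strong_entourage (K n) (\<epsilon> n)"
      using y(2) \<epsilon> by (intro strong_entourage_compactI comp K f y(1)) simp
    then show ?thesis using fU by blast
  qed
  have fin: "finite (range y \<inter> strong_entourage C 1 `` {h})" if "h \<in> cont_funs" for h
  proof -
    have "compact (h ` C)"
      using that comp[OF C(1)] unfolding cont_funs_def
      by (auto intro: compact_continuous_image continuous_on_subset)
    then obtain M where M: "\<And>x. x \<in> C \<Longrightarrow> \<bar>h x\<bar> \<le> M"
      using compact_imp_bounded bounded_iff by (metis imageI real_norm_def)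
    \<comment> \<open>Closeness at \<open>p n\<close> gives n = \<open>y n (p n)\<close> < M + 1,
      which leaves only finitely many indices.\<close>
    have "n \<le> nat \<lceil>M + 1\<rceil>" if "(h, y n) \<in> strong_entourage C 1" for n
      using strong_entourage_imp_close[OF that p(1)[of n]] M[OF p(1)[of n]] p(2)[of n] by linarith
    then have "range y \<inter> strong_entourage C 1 `` {h} \<subseteq> y ` {..nat \<lceil>M + 1\<rceil>}" by auto
    then show ?thesis by (meson finite_atMost finite_imageI finite_subset)
  qed
  \<comment> \<open>Closedness of every subset, not just of the whole range, is what yields
    discreteness.\<close>
  have "closedin (strong_topology \<BB>) T" if T: "T \<subseteq> range y" for T
  proof (rule closedin_strong_topology_locally_finite[OF born])
    show "T \<subseteq> cont_funs" using T y(1) by blast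
    show "\<exists>E\<in>strong_uniformity \<BB>. finite (T \<inter> E `` {h})" if "h \<in> cont_funs" for h
    proof (intro bexI)
      show "strong_entourage C 1 \<in> strong_uniformity \<BB>"
        using C(1) sub strong_entourage_in_uniformity by (metis subsetD zero_less_one)
      show "finite (T \<inter> strong_entourage C 1 `` {h})"
        using fin[OF that] T by (meson Int_mono finite_subset order_refl)
    qed
  qed
  then show "\<exists>y. (\<forall>n. y n \<in> U n) \<and> closedin (strong_topology \<BB>) (range y) \<and>
      subtopology (strong_topology \<BB>) (range y) = discrete_topology (range y)"
    using yU subtopology_eq_discrete_topology_if_closedin by (metis order_refl)
qed

text \<open>Uncountability is asked of every compact base: the bounded subsets of the real line have
  the uncountable base of all compact sets, but also the countable base of the intervals [-n, n], so
  selectivity fails there.\<close>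

theorem theorem5p8:
  fixes \<BB> :: "'a::metric_space set set"
  assumes "infinite (UNIV :: 'a set)"
    and "bornology \<BB>"
    and "\<exists>\<BB>\<^sub>0. compact_base \<BB> \<BB>\<^sub>0"
    and "UNIV \<notin> \<BB>"
  shows "(\<forall>\<BB>\<^sub>0. compact_base \<BB> \<BB>\<^sub>0 \<longrightarrow> uncountable \<BB>\<^sub>0)
     \<longleftrightarrow> discretely_selective (strong_topology \<BB>)"
  using assms(2,3) not_discretely_selective_if_countable_base
    discretely_selective_if_no_countable_base by blast

end
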